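(* Let $F:\mathbb R^d\to\mathbb R$ be $L_1$-smooth w.r.t. $\|\cdot\|_1$ with partial derivatives that are $L_2$-smooth w.r.t. $\|\cdot\|_1$. Let $x^1,\dots,x^T\in\Delta_d$ be deterministic vectors and $a^1,\dots,a^T\in\Delta_d$ be random vectors such that $\mathbb E[a^t\mid a^{t-1},\dots,a^1]=x^t$ for all $t\in[T]$. Let $\bar x^T=\frac1T\sum_{t=1}^Tx^t$ and $\bar a^T=\frac1T\sum_{t=1}^Ta^t$. Then $$\mathbb E\big\|\nabla F(\bar a^T)-\nabla F(\bar x^T)\big\|_\infty^2\le\frac{8L_2^2}{T^2}+\frac{8L_1^2(4+\log(d))}{T}.$$
   Context: $\Delta_d=\{x\in\mathbb R^d:x_j\ge0,\ \sum_jx_j=1\}$. A differentiable function $G:\mathbb R^d\to\mathbb R$ is $L$-smooth w.r.t. $\|\cdot\|_1$ if $\|\nabla G(u)-\nabla G(u')\|_\infty\le L\|u-u'\|_1$ for all $u,u'$. $\log$ is the natural logarithm. *)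

theory Defs
  imports "HOL-Probability.Probability"
begin

definition partial_deriv :: "'d::finite \<Rightarrow> (real ^ 'd \<Rightarrow> real) \<Rightarrow> real ^ 'd \<Rightarrow> real" where
  "partial_deriv i f x = deriv (\<lambda>h. f (x + h *\<^sub>R axis i 1)) 0"

definition grad :: "(real ^ 'd::finite \<Rightarrow> real) \<Rightarrow> real ^ 'd \<Rightarrow> real ^ 'd" where
  "grad f x = (\<chi> i. partial_deriv i f x)"

(* The norm of the type real ^ 'd is Euclidean; the sup norm is the library's infnorm. *)
definition l1_norm :: "real ^ 'd::finite \<Rightarrow> real" where
  "l1_norm x = (\<Sum>i\<in>UNIV. \<bar>x $ i\<bar>)"

definition smooth_l1 :: "real \<Rightarrow> (real ^ 'd::finite \<Rightarrow> real) \<Rightarrow> bool" where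
  "smooth_l1 L G \<longleftrightarrow>
     (\<forall>u. G differentiable (at u)) \<and>
     (\<forall>u u'. infnorm (grad G u - grad G u') \<le> L * l1_norm (u - u'))"

definition prob_simplex :: "(real ^ 'd::finite) set" where
  "prob_simplex = {x. (\<forall>j. 0 \<le> x $ j) \<and> (\<Sum>j\<in>UNIV. x $ j) = 1}"

(* The sigma-algebra generated by X s, s \<in> S, on the space of M; the trivial one if S is empty. *)
definition gen_sigma ::
  "'w measure \<Rightarrow> 'i set \<Rightarrow> ('i \<Rightarrow> 'w \<Rightarrow> 'b::topological_space) \<Rightarrow> 'w measure" where
  "gen_sigma M S X =
     sigma (space M) (\<Union>s\<in>S. {X s -` A \<inter> space M | A. A \<in> sets borel})"

(* The library's conditional expectation is real-valued, so it is taken coordinatewise. *)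
definition vec_cond_exp ::
  "'w measure \<Rightarrow> 'w measure \<Rightarrow> ('w \<Rightarrow> real ^ 'd::finite) \<Rightarrow> 'w \<Rightarrow> real ^ 'd" where
  "vec_cond_exp M N X w = (\<chi> i. real_cond_exp M N (\<lambda>v. X v $ i) w)"

end

theory Submission
  imports Defs
begin

text \<open>
  Walk from \<open>xbar\<close> to \<open>abar\<close> along the points \<open>y t = xbar + (\<Sum>s<t. a s - x s) / T\<close>. Expanding
  \<open>g = partial_deriv i F\<close> to first order at each step writes \<open>g abar - g xbar\<close> as a martingale
  \<open>\<Sum>t. grad g (y t) \<bullet> (a t - x t) / T\<close> plus \<open>T\<close> second-order errors of at most \<open>2 L2 / T^2\<close> each.
  The entries of \<open>grad g\<close> are bounded by \<open>L1\<close> and \<open>a t\<close> lies in the simplex, so by Hoeffding's lemma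
  the martingale is sub-Gaussian with variance proxy \<open>L1^2 / T\<close>. The expected maximum of the squares
  of \<open>d\<close> such martingales is then at most \<open>2 ln d\<close> plus a constant, times this proxy.
\<close>

section \<open>Partial derivatives, gradients and the l1 norm\<close>

lemma partial_deriv_eq:
  assumes "(G has_derivative D) (at u)"
  shows "((\<lambda>h. G (u + h *\<^sub>R axis i 1)) has_real_derivative D (axis i 1)) (at 0)"
    and "partial_deriv i G u = D (axis i 1)"
proof -
  have "((\<lambda>h. G (u + h *\<^sub>R axis i 1)) has_derivative (\<lambda>h. D (h *\<^sub>R axis i 1))) (at (0::real))"
    by (rule has_derivative_compose[where g = G and f = "\<lambda>h. u + h *\<^sub>R axis i 1"])
       (auto intro!: derivative_eq_intros assms)
  moreover have "D (h *\<^sub>R axis i 1) = D (axis i 1) * h" for h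
    using linear_scale[OF has_derivative_linear[OF assms]] by (simp add: mult.commute)
  ultimately show d: "((\<lambda>h. G (u + h *\<^sub>R axis i 1)) has_real_derivative D (axis i 1)) (at 0)"
    by (simp add: has_field_derivative_def)
  show "partial_deriv i G u = D (axis i 1)"
    unfolding partial_deriv_def using d by (rule DERIV_imp_deriv)
qed

lemma has_derivative_grad:
  assumes "G differentiable (at u)"
  shows "(G has_derivative (\<lambda>h. grad G u \<bullet> h)) (at u)"
proof -
  obtain D where D: "(G has_derivative D) (at u)"
    using assms by (auto simp: differentiable_def)
  have lin: "linear D"
    using D by (rule has_derivative_linear)
  have "D h = grad G u \<bullet> h" for h
  proof -
    have "D h = D (\<Sum>i\<in>UNIV. h $ i *\<^sub>R axis i 1)"
      using basis_expansion[of h] by (simp add: scalar_mult_eq_scaleR)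
    also have "\<dots> = (\<Sum>i\<in>UNIV. h $ i * D (axis i 1))"
      by (simp add: linear_sum[OF lin] linear_scale[OF lin])
    finally show ?thesis
      by (simp add: grad_def inner_vec_def partial_deriv_eq(2)[OF D] mult.commute)
  qed
  then have "D = (\<lambda>h. grad G u \<bullet> h)" by auto
  with D show ?thesis by simp
qed

lemma abs_inner_le_l1:
  assumes "\<And>j. \<bar>v $ j\<bar> \<le> c"
  shows "\<bar>v \<bullet> h\<bar> \<le> c * l1_norm h"
proof -
  have "\<bar>v \<bullet> h\<bar> \<le> (\<Sum>j\<in>UNIV. \<bar>v $ j * h $ j\<bar>)"
    by (simp add: inner_vec_def sum_abs)
  also have "\<dots> \<le> (\<Sum>j\<in>UNIV. c * \<bar>h $ j\<bar>)"
    by (intro sum_mono) (simp add: abs_mult assms mult_right_mono)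
  finally show ?thesis by (simp add: l1_norm_def sum_distrib_left)
qed

lemma l1_norm_scaleR: "l1_norm (r *\<^sub>R h) = \<bar>r\<bar> * l1_norm h"
  by (simp add: l1_norm_def abs_mult sum_distrib_left)

lemma l1_norm_nonneg: "0 \<le> l1_norm h"
  by (simp add: l1_norm_def sum_nonneg)

lemma l1_norm_axis: "l1_norm (axis i (1::real)) = 1"
proof -
  have "\<bar>axis i (1::real) $ j\<bar> = (if j = i then 1 else 0)" for j
    by (simp add: axis_def)
  then show ?thesis by (simp add: l1_norm_def)
qed

lemma l1_norm_diff_simplex:
  assumes "p \<in> prob_simplex" "q \<in> prob_simplex"
  shows "l1_norm (p - q) \<le> 2"
proof -
  have "l1_norm (p - q) \<le> (\<Sum>j\<in>UNIV. p $ j + q $ j)"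
    unfolding l1_norm_def using assms
    by (intro sum_mono) (auto simp: prob_simplex_def abs_le_iff intro: add_increasing add_increasing2)
  with assms show ?thesis by (simp add: sum.distrib prob_simplex_def)
qed

lemma smooth_l1D:
  assumes "smooth_l1 L G"
  shows "G differentiable (at u)"
    and "\<bar>grad G u $ j - grad G u' $ j\<bar> \<le> L * l1_norm (u - u')"
proof -
  show "G differentiable (at u)" using assms by (simp add: smooth_l1_def)
  have "\<bar>(grad G u - grad G u') $ j\<bar> \<le> infnorm (grad G u - grad G u')"
    by (rule component_le_infnorm_cart)
  also have "\<dots> \<le> L * l1_norm (u - u')" using assms by (simp add: smooth_l1_def)
  finally show "\<bar>grad G u $ j - grad G u' $ j\<bar> \<le> L * l1_norm (u - u')" by simp
qed

text \<open>Each entry is Lipschitz in the l1 norm, so its increments are squeezed to 0. Continuity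
  makes the gradients Borel, which gives measurability of the martingale coefficients and of the
  final integrand.\<close>

lemma continuous_on_grad:
  fixes G :: "real ^ 'd::finite \<Rightarrow> real"
  assumes "smooth_l1 L G"
  shows "continuous_on UNIV (grad G)"
proof -
  have "continuous (at u) (\<lambda>z. grad G z $ j)" for u j
    unfolding continuous_at
  proof (rule LIM_zero_cancel, rule Lim_null_comparison)
    show "\<forall>\<^sub>F z in at u. norm (grad G z $ j - grad G u $ j) \<le> L * l1_norm (z - u)"
      using smooth_l1D(2)[OF assms] by simp
    have "((\<lambda>z. L * (\<Sum>i\<in>UNIV. \<bar>(z - u) $ i\<bar>)) \<longlongrightarrow> L * (\<Sum>i\<in>UNIV. \<bar>(u - u) $ i\<bar>)) (at u)"
      by (intro tendsto_intros)
    then show "((\<lambda>z. L * l1_norm (z - u)) \<longlongrightarrow> 0) (at u)"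
      by (simp add: l1_norm_def)
  qed
  then have "continuous_on UNIV (\<lambda>z. \<chi> j. grad G z $ j)"
    by (intro continuous_on_vec_lambda continuous_at_imp_continuous_on) auto
  then show ?thesis by simp
qed

text \<open>The difference quotients along \<open>axis j 1\<close>, a vector of l1 norm 1, are at
  most \<open>L\<close> in absolute value, and so is their limit. Applied to a partial derivative of
  \<open>F\<close>, this bounds the second partial derivatives.\<close>

lemma grad_bound_of_lipschitz:
  assumes diff: "G differentiable (at u)"
    and lip: "\<And>w. \<bar>G w - G u\<bar> \<le> L * l1_norm (w - u)"
  shows "\<bar>grad G u $ j\<bar> \<le> L"
proof -
  obtain D where D: "(G has_derivative D) (at u)"
    using diff by (auto simp: differentiable_def)
  have "((\<lambda>h. (G (u + h *\<^sub>R axis j 1) - G u) / h) \<longlongrightarrow> grad G u $ j) (at 0)"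
    using partial_deriv_eq[OF D] by (simp add: DERIV_def grad_def)
  then have lim: "((\<lambda>h. \<bar>(G (u + h *\<^sub>R axis j 1) - G u) / h\<bar>) \<longlongrightarrow> \<bar>grad G u $ j\<bar>) (at 0)"
    by (rule tendsto_rabs)
  have "\<bar>(G (u + h *\<^sub>R axis j 1) - G u) / h\<bar> \<le> L" if "h \<noteq> 0" for h
    using lip[of "u + h *\<^sub>R axis j 1"] that
    by (simp add: l1_norm_scaleR l1_norm_axis abs_divide field_simps)
  then have "\<forall>\<^sub>F h in at 0. \<bar>(G (u + h *\<^sub>R axis j 1) - G u) / h\<bar> \<le> L"
    by (auto simp: eventually_at_filter)
  with lim show ?thesis
    by (intro tendsto_upperbound[OF lim]) auto
qed

section \<open>First-order expansion with a quadratic error in the l1 norm\<close>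

text \<open>On the segment from \<open>y\<close> to \<open>y + h\<close>, \<open>\<psi>\<close>
  subtracts the linear term and the quadratic majorant. The Lipschitz bound at distance
  \<open>s * l1_norm h\<close> makes its derivative nonpositive, and the claim is
  \<open>\<psi> 1 \<le> \<psi> 0\<close>.\<close>

lemma first_order_upper_bound:
  fixes G :: "real ^ 'd::finite \<Rightarrow> real"
  assumes diff: "\<And>u. G differentiable (at u)"
    and lip: "\<And>u u' j. \<bar>grad G u $ j - grad G u' $ j\<bar> \<le> L * l1_norm (u - u')"
  shows "G (y + h) - G y - grad G y \<bullet> h \<le> L / 2 * (l1_norm h)\<^sup>2"
proof -
  define \<psi> where "\<psi> s = G (y + s *\<^sub>R h) - s * (grad G y \<bullet> h) - L / 2 * (l1_norm h)\<^sup>2 * s\<^sup>2" for s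
  have line: "((\<lambda>s. G (y + s *\<^sub>R h)) has_real_derivative grad G (y + s *\<^sub>R h) \<bullet> h) (at s)" for s
  proof -
    have "((\<lambda>s. G (y + s *\<^sub>R h)) has_derivative (\<lambda>r. grad G (y + s *\<^sub>R h) \<bullet> (r *\<^sub>R h))) (at s)"
      by (rule has_derivative_compose[where g = G and f = "\<lambda>s. y + s *\<^sub>R h"])
         (auto intro!: derivative_eq_intros has_derivative_grad diff)
    then show ?thesis
      by (simp add: has_field_derivative_def mult.commute[of _ "_ \<bullet> _"])
  qed
  have "\<psi> 1 \<le> \<psi> 0"
  proof (rule DERIV_nonpos_imp_nonincreasing[where f = \<psi>])
    fix s :: real
    assume s: "0 \<le> s" "s \<le> 1"
    have "\<bar>(grad G (y + s *\<^sub>R h) - grad G y) \<bullet> h\<bar> \<le> (L * (s * l1_norm h)) * l1_norm h"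
      using lip[of "y + s *\<^sub>R h" _ y] s by (intro abs_inner_le_l1) (simp add: l1_norm_scaleR)
    then have "grad G (y + s *\<^sub>R h) \<bullet> h - grad G y \<bullet> h - L * s * (l1_norm h)\<^sup>2 \<le> 0"
      by (simp add: inner_diff_left power2_eq_square mult_ac)
    moreover have "(\<psi> has_real_derivative
        grad G (y + s *\<^sub>R h) \<bullet> h - grad G y \<bullet> h - L * s * (l1_norm h)\<^sup>2) (at s)"
      unfolding \<psi>_def by (auto intro!: derivative_eq_intros line)
    ultimately show "\<exists>y. (\<psi> has_real_derivative y) (at s) \<and> y \<le> 0" by blast
  qed simp
  then show ?thesis by (simp add: \<psi>_def)
qed

lemma partial_deriv_uminus:
  assumes "G differentiable (at u)"
  shows "partial_deriv i (\<lambda>z. - G z) u = - partial_deriv i G u"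
proof -
  obtain D where D: "(G has_derivative D) (at u)"
    using assms by (auto simp: differentiable_def)
  show ?thesis
    using partial_deriv_eq(2)[OF D] partial_deriv_eq(2)[OF has_derivative_minus[OF D]] by simp
qed

text \<open>Two one-sided bounds, for \<open>G\<close> and for \<open>- G\<close>, whose gradient
  obeys the same Lipschitz estimate.\<close>

lemma first_order_error:
  fixes G :: "real ^ 'd::finite \<Rightarrow> real"
  assumes "smooth_l1 L G"
  shows "\<bar>G (y + h) - G y - grad G y \<bullet> h\<bar> \<le> L / 2 * (l1_norm h)\<^sup>2"
proof -
  note d = smooth_l1D(1)[OF assms] and l = smooth_l1D(2)[OF assms]
  have m: "grad (\<lambda>z. - G z) u = - grad G u" for u
    by (simp add: grad_def vec_eq_iff partial_deriv_uminus[OF d])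
  have "G (y + h) - G y - grad G y \<bullet> h \<le> L / 2 * (l1_norm h)\<^sup>2"
    by (rule first_order_upper_bound[OF d l])
  moreover have "- G (y + h) - - G y - grad (\<lambda>z. - G z) y \<bullet> h \<le> L / 2 * (l1_norm h)\<^sup>2"
  proof (rule first_order_upper_bound[where G = "\<lambda>z. - G z"])
    show "\<bar>grad (\<lambda>z. - G z) u $ j - grad (\<lambda>z. - G z) u' $ j\<bar> \<le> L * l1_norm (u - u')" for u u' j
      using l[of u j u'] by (simp add: m)
  qed (simp add: d)
  ultimately show ?thesis by (simp only: m inner_minus_left abs_le_iff) simp
qed

section \<open>Convexity of exp and Hoeffding's lemma on the simplex\<close>

lemma exp_inner_simplex_le:
  assumes "p \<in> prob_simplex"
  shows "exp (v \<bullet> p) \<le> (\<Sum>j\<in>UNIV. p $ j * exp (v $ j))"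
proof -
  have "exp (\<Sum>j\<in>UNIV. p $ j *\<^sub>R v $ j) \<le> (\<Sum>j\<in>UNIV. p $ j * exp (v $ j))"
    using assms by (intro convex_on_sum[OF _ _ convex_on_exp[of 1, simplified]])
      (auto simp: prob_simplex_def)
  then show ?thesis by (simp add: inner_vec_def mult.commute)
qed

text \<open>A variable taking the value \<open>v $ j\<close> with probability \<open>p $ j\<close>
  has mean \<open>v \<bullet> p\<close> and lives in an interval of length \<open>2 * c\<close>,
  hence the exponent \<open>(2 * c)\<^sup>2 / 8\<close> of Hoeffding's lemma.\<close>

lemma Hoeffdings_lemma_simplex:
  assumes p: "p \<in> prob_simplex" and c: "c > 0" and v: "\<And>j. \<bar>v $ j\<bar> \<le> c"
  shows "(\<Sum>j\<in>UNIV. p $ j * exp (v $ j - v \<bullet> p)) \<le> exp (c\<^sup>2 / 2)"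
proof -
  \<comment> \<open>The weight of the endpoint \<open>c\<close> in the law on \<open>- c\<close> and
    \<open>c\<close> with mean \<open>v \<bullet> p\<close>.\<close>
  define q where "q = (c + v \<bullet> p) / (2 * c)"
  have sum1: "(\<Sum>j\<in>UNIV. p $ j) = 1" and nn: "0 \<le> p $ j" for j
    using p by (auto simp: prob_simplex_def)
  have "\<bar>v \<bullet> p\<bar> \<le> c"
    using abs_inner_le_l1[OF v, of p] nn sum1 by (simp add: l1_norm_def)
  then have q: "q \<ge> 0" using c by (simp add: q_def)
  \<comment> \<open>The exponential lies below its chord over the interval from \<open>- c\<close>
    to \<open>c\<close>; \<open>exp (- c)\<close> is factored out to reach the shape of
    \<open>Hoeffdings_lemma_aux\<close>.\<close>
  have chord: "exp (v $ j) \<le> exp (- c) * (1 + (c + v $ j) / (2 * c) * (exp (2 * c) - 1))" for j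
  proof -
    define s where "s = (c + v $ j) / (2 * c)"
    have s: "0 \<le> s" "s \<le> 1" using v[of j] c by (auto simp: s_def field_simps)
    have "exp ((1 - s) *\<^sub>R (- c) + s *\<^sub>R c) \<le> (1 - s) * exp (- c) + s * exp c"
      using s by (intro convex_onD[OF convex_on_exp[of 1, simplified]]) auto
    moreover have "(1 - s) *\<^sub>R (- c) + s *\<^sub>R c = v $ j"
      using c by (simp add: s_def field_simps)
    moreover have "exp (- c) * (1 + s * (exp (2 * c) - 1)) = (1 - s) * exp (- c) + s * exp c"
    proof -
      have "exp (- c) * exp (2 * c) = exp c" by (simp flip: exp_add)
      then show ?thesis by (simp add: right_diff_distrib left_diff_distrib distrib_left mult.left_commute)
    qed
    ultimately show ?thesis by (simp flip: s_def)
  qed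
  have "(\<Sum>j\<in>UNIV. p $ j * exp (v $ j))
      \<le> (\<Sum>j\<in>UNIV. p $ j * (exp (- c) * (1 + (c + v $ j) / (2 * c) * (exp (2 * c) - 1))))"
    by (intro sum_mono mult_left_mono chord nn)
  \<comment> \<open>The chord is affine in \<open>v $ j\<close>, so averaging keeps only the mean,
    through \<open>q\<close>.\<close>
  also have "\<dots> = exp (- c) * ((\<Sum>j\<in>UNIV. p $ j) +
      (c * (\<Sum>j\<in>UNIV. p $ j) + (\<Sum>j\<in>UNIV. v $ j * p $ j)) / (2 * c) * (exp (2 * c) - 1))"
    unfolding sum_distrib_left sum_distrib_right sum_divide_distrib sum.distrib[symmetric]
    by (intro sum.cong refl) (simp add: field_simps c)
  also have "\<dots> = exp (- c) * (1 + q * (exp (2 * c) - 1))"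
    by (simp add: sum1 q_def inner_vec_def)
  finally have A: "(\<Sum>j\<in>UNIV. p $ j * exp (v $ j)) \<le> exp (- c) * (1 + q * (exp (2 * c) - 1))" .
  have pos: "1 + q * (exp (2 * c) - 1) > 0"
    using q c by (intro add_pos_nonneg mult_nonneg_nonneg) auto
  have "(\<Sum>j\<in>UNIV. p $ j * exp (v $ j - v \<bullet> p))
      = exp (- (v \<bullet> p)) * (\<Sum>j\<in>UNIV. p $ j * exp (v $ j))"
    unfolding sum_distrib_left by (intro sum.cong refl) (simp add: exp_diff exp_minus field_simps)
  also have "\<dots> \<le> exp (- (v \<bullet> p)) * (exp (- c) * (1 + q * (exp (2 * c) - 1)))"
    by (intro mult_left_mono A) simp
  also have "\<dots> = exp (- (2 * c) * q + ln (1 + q * (exp (2 * c) - 1)))"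
  proof -
    have "- (2 * c) * q = - (v \<bullet> p) + - c" using c by (simp add: q_def field_simps)
    then show ?thesis using pos by (simp only: exp_add exp_ln mult.assoc)
  qed
  also have "\<dots> \<le> exp ((2 * c)\<^sup>2 / 8)"
    using Hoeffdings_lemma_aux[of "2 * c" q] c q by simp
  finally show ?thesis by (simp add: power2_eq_square)
qed

section \<open>Sigma-algebras generated by the past\<close>

lemma space_gen_sigma [simp]: "space (gen_sigma M S X) = space M"
  unfolding gen_sigma_def by (rule space_measure_of) auto

lemma sets_gen_sigma:
  "sets (gen_sigma M S X)
     = sigma_sets (space M) (\<Union>s\<in>S. {X s -` A \<inter> space M | A. A \<in> sets borel})"
  unfolding gen_sigma_def by (rule sets_measure_of) auto

lemma gen_sigma_mono:
  assumes "S \<subseteq> S'" shows "sets (gen_sigma M S X) \<subseteq> sets (gen_sigma M S' X)"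
  unfolding sets_gen_sigma using assms by (intro sigma_sets_subseteq UN_mono) auto

lemma measurable_gen_sigma_mono:
  assumes "S \<subseteq> S'" "f \<in> borel_measurable (gen_sigma M S X)"
  shows "f \<in> borel_measurable (gen_sigma M S' X)"
  using assms gen_sigma_mono[OF assms(1), of M X]
  by (auto simp: measurable_def)

lemma measurable_gen_sigma:
  assumes "s \<in> S" shows "X s \<in> borel_measurable (gen_sigma M S X)"
  using assms by (intro measurableI) (auto simp: sets_gen_sigma)

lemma subalgebra_gen_sigma:
  assumes "\<And>s. s \<in> S \<Longrightarrow> X s \<in> borel_measurable M"
  shows "subalgebra M (gen_sigma M S X)"
  unfolding subalgebra_def sets_gen_sigma
  using assms by (auto intro!: sets.sigma_sets_subset)

lemma borel_measurable_vec_nth [measurable]: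
  fixes f :: "'a \<Rightarrow> real ^ 'd::finite"
  assumes "f \<in> borel_measurable N"
  shows "(\<lambda>w. f w $ j) \<in> borel_measurable N"
proof -
  have "(\<lambda>w. f w \<bullet> axis j 1) \<in> borel_measurable N"
    using assms by measurable
  then show ?thesis by (simp add: inner_axis)
qed

section \<open>Exponential moments of the martingale\<close>

text \<open>
  Given the past, Jensen's inequality \<open>exp (v \<bullet> a) \<le> (\<Sum>j. a $ j * exp (v $ j))\<close> makes the increment
  linear in \<open>a\<close>, so conditioning merely replaces \<open>a\<close> by \<open>x\<close>, and what remains is Hoeffding's lemma
  for the fixed distribution \<open>x\<close>.
\<close>

lemma exp_martingale_bound:
  fixes a :: "nat \<Rightarrow> 'w \<Rightarrow> real ^ 'd::finite" and v :: "nat \<Rightarrow> 'w \<Rightarrow> real ^ 'd"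
  assumes M: "prob_space M"
    and x: "\<And>t. t \<in> {1..T} \<Longrightarrow> x t \<in> prob_simplex"
    and meas: "\<And>t. t \<in> {1..T} \<Longrightarrow> a t \<in> borel_measurable M"
    and a: "\<And>t. t \<in> {1..T} \<Longrightarrow> AE w in M. a t w \<in> prob_simplex"
    and cond: "\<And>t. t \<in> {1..T} \<Longrightarrow>
           AE w in M. vec_cond_exp M (gen_sigma M {1..<t} a) (a t) w = x t"
    and v: "\<And>t. t \<in> {1..T} \<Longrightarrow> v t \<in> borel_measurable (gen_sigma M {1..<t} a)"
    and c: "c > 0" "\<And>t w j. t \<in> {1..T} \<Longrightarrow> \<bar>v t w $ j\<bar> \<le> c"
    and n: "n \<le> T"
  shows "integrable M (\<lambda>w. exp (\<Sum>t=1..n. v t w \<bullet> (a t w - x t))) \<and>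
    (\<integral>w. exp (\<Sum>t=1..n. v t w \<bullet> (a t w - x t)) \<partial>M) \<le> exp (real n * c\<^sup>2 / 2)"
  using n
proof (induction n)
  case 0
  interpret prob_space M by fact
  show ?case by (simp add: prob_space)
next
  case (Suc n)
  interpret prob_space M by fact
  \<comment> \<open>The past of step \<open>Suc n\<close>: generated by \<open>a 1\<close> to
    \<open>a n\<close>, without \<open>a (Suc n)\<close>.\<close>
  define N where "N = gen_sigma M {1..<Suc n} a"
  define Z where "Z w = exp (\<Sum>t=1..n. v t w \<bullet> (a t w - x t))" for w
  \<comment> \<open>The coefficient of \<open>a (Suc n) w $ j\<close> left by Jensen's inequality;
    it is known given the past.\<close>
  define f where "f j w = Z w * exp (v (Suc n) w $ j - v (Suc n) w \<bullet> x (Suc n))" for j w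
  have IH: "integrable M Z" "(\<integral>w. Z w \<partial>M) \<le> exp (real n * c\<^sup>2 / 2)"
    using Suc unfolding Z_def by auto
  have T: "Suc n \<in> {1..T}" using Suc.prems by auto
  have sub: "subalgebra M N"
    unfolding N_def using Suc.prems by (intro subalgebra_gen_sigma meas) auto
  interpret finite_measure_subalgebra M N
    by standard (rule sub)
  have [measurable]: "v (Suc n) \<in> borel_measurable N"
    unfolding N_def by (rule v[OF T])
  have [measurable]: "Z \<in> borel_measurable N"
  proof -
    have "(\<lambda>w. v t w \<bullet> (a t w - x t)) \<in> borel_measurable N" if t: "t \<in> {1..n}" for t
    proof -
      have [measurable]: "v t \<in> borel_measurable N" unfolding N_def
        by (rule measurable_gen_sigma_mono[OF _ v]) (use t Suc.prems in auto)
      have [measurable]: "a t \<in> borel_measurable N" unfolding N_def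
        by (rule measurable_gen_sigma) (use t in auto)
      show ?thesis by measurable
    qed
    then have [measurable]: "(\<lambda>w. \<Sum>t=1..n. v t w \<bullet> (a t w - x t)) \<in> borel_measurable N"
      by (rule borel_measurable_sum)
    show ?thesis unfolding Z_def by measurable
  qed
  have fN [measurable]: "f j \<in> borel_measurable N" for j
    unfolding f_def by measurable
  have [measurable]: "a (Suc n) \<in> borel_measurable M"
    by (rule meas[OF T])
  have ZM [measurable]: "Z \<in> borel_measurable M" and fM [measurable]: "f j \<in> borel_measurable M"
    and [measurable]: "v (Suc n) \<in> borel_measurable M" for j
    by (rule measurable_from_subalg[OF sub], measurable)+
  have vx: "\<bar>v (Suc n) w \<bullet> x (Suc n)\<bar> \<le> c" for w
    using abs_inner_le_l1[OF c(2)[OF T], of w "x (Suc n)"] x[OF T]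
    by (simp add: l1_norm_def prob_simplex_def)
  \<comment> \<open>Both \<open>v (Suc n) w $ j\<close> and the average of these entries under
    \<open>x (Suc n)\<close> are at most \<open>c\<close> in absolute value, so \<open>Z\<close>,
    integrable by induction, dominates up to a constant.\<close>
  have f_le: "0 \<le> f j w" "f j w \<le> Z w * exp (2 * c)" for j w
    using vx[of w] c(2)[OF T, of w j] by (auto simp: f_def Z_def)
  have Zpos: "0 \<le> Z w" for w by (simp add: Z_def)
  have int_fa: "integrable M (\<lambda>w. f j w * a (Suc n) w $ j)" for j
  proof (rule Bochner_Integration.integrable_bound)
    show "integrable M (\<lambda>w. Z w * exp (2 * c))" using IH(1) by simp
    show "AE w in M. norm (f j w * a (Suc n) w $ j) \<le> norm (Z w * exp (2 * c))"
      using a[OF T]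
    proof eventually_elim
      case (elim w)
      then have "0 \<le> a (Suc n) w $ j" "a (Suc n) w $ j \<le> 1"
        using member_le_sum[of j UNIV "\<lambda>j. a (Suc n) w $ j"] by (auto simp: prob_simplex_def)
      then have "f j w * a (Suc n) w $ j \<le> (Z w * exp (2 * c)) * 1"
        using f_le(1)[of j w] f_le(2)[of j w] by (intro mult_mono) auto
      with f_le(1)[of j w] f_le(2)[of j w] \<open>0 \<le> a (Suc n) w $ j\<close> Zpos[of w] show ?case by simp
    qed
  qed measurable
  have condj: "AE w in M. real_cond_exp M N (\<lambda>w. a (Suc n) w $ j) w = x (Suc n) $ j" for j
    using cond[OF T] by eventually_elim (auto simp: vec_cond_exp_def N_def vec_eq_iff)
  \<comment> \<open>Since \<open>f j\<close> is \<open>N\<close>-measurable, it can be pulled out of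
    the conditional expectation, which turns \<open>a (Suc n) w $ j\<close> into the constant
    \<open>x (Suc n) $ j\<close>.\<close>
  have key: "integrable M (\<lambda>w. f j w * x (Suc n) $ j)"
    "(\<integral>w. f j w * a (Suc n) w $ j \<partial>M) = (\<integral>w. f j w * x (Suc n) $ j \<partial>M)" for j
  proof -
    have [measurable]: "(\<lambda>w. a (Suc n) w $ j) \<in> borel_measurable M" by measurable
    note * = real_cond_exp_intg[OF int_fa fN, of j]
    have [measurable]: "real_cond_exp M N (\<lambda>w. a (Suc n) w $ j) \<in> borel_measurable M"
      by simp
    have ae: "AE w in M. f j w * real_cond_exp M N (\<lambda>w. a (Suc n) w $ j) w = f j w * x (Suc n) $ j"
      using condj[of j] by eventually_elim simp
    show "integrable M (\<lambda>w. f j w * x (Suc n) $ j)"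
      by (rule integrable_cong_AE_imp[OF *(1)]) (use ae in \<open>auto elim: eventually_mono\<close>)
    have "(\<integral>w. f j w * real_cond_exp M N (\<lambda>w. a (Suc n) w $ j) w \<partial>M) = (\<integral>w. f j w * x (Suc n) $ j \<partial>M)"
      by (rule integral_cong_AE) (use ae in auto)
    with *(2) show "(\<integral>w. f j w * a (Suc n) w $ j \<partial>M) = (\<integral>w. f j w * x (Suc n) $ j \<partial>M)" by simp
  qed
  have step: "exp (\<Sum>t=1..Suc n. v t w \<bullet> (a t w - x t))
      = Z w * exp (v (Suc n) w \<bullet> (a (Suc n) w - x (Suc n)))" for w
    by (simp add: Z_def exp_add)
  have Jensen: "AE w in M. Z w * exp (v (Suc n) w \<bullet> (a (Suc n) w - x (Suc n)))
      \<le> (\<Sum>j\<in>UNIV. f j w * a (Suc n) w $ j)"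
    using a[OF T]
  proof eventually_elim
    case (elim w)
    have "Z w * exp (v (Suc n) w \<bullet> (a (Suc n) w - x (Suc n)))
        = Z w * exp (- (v (Suc n) w \<bullet> x (Suc n))) * exp (v (Suc n) w \<bullet> a (Suc n) w)"
      by (simp add: inner_diff_right exp_diff exp_minus field_simps)
    also have "\<dots> \<le> Z w * exp (- (v (Suc n) w \<bullet> x (Suc n))) *
        (\<Sum>j\<in>UNIV. a (Suc n) w $ j * exp (v (Suc n) w $ j))"
      by (intro mult_left_mono exp_inner_simplex_le elim) (simp add: Zpos)
    also have "\<dots> = (\<Sum>j\<in>UNIV. f j w * a (Suc n) w $ j)"
      unfolding sum_distrib_left
      by (intro sum.cong refl) (simp add: f_def exp_diff exp_minus field_simps)
    finally show ?case .
  qed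
  have int: "integrable M (\<lambda>w. Z w * exp (v (Suc n) w \<bullet> (a (Suc n) w - x (Suc n))))"
  proof (rule Bochner_Integration.integrable_bound)
    show "integrable M (\<lambda>w. \<Sum>j\<in>UNIV. f j w * a (Suc n) w $ j)"
      by (intro Bochner_Integration.integrable_sum int_fa)
    show "AE w in M. norm (Z w * exp (v (Suc n) w \<bullet> (a (Suc n) w - x (Suc n))))
        \<le> norm (\<Sum>j\<in>UNIV. f j w * a (Suc n) w $ j)"
      using Jensen
    proof eventually_elim
      case (elim w)
      have "0 \<le> Z w * exp (v (Suc n) w \<bullet> (a (Suc n) w - x (Suc n)))"
        by (simp add: Zpos)
      with elim show ?case by simp
    qed
  qed measurable
  have "(\<integral>w. Z w * exp (v (Suc n) w \<bullet> (a (Suc n) w - x (Suc n))) \<partial>M)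
      \<le> (\<integral>w. (\<Sum>j\<in>UNIV. f j w * a (Suc n) w $ j) \<partial>M)"
    by (intro integral_mono_AE int Jensen Bochner_Integration.integrable_sum int_fa)
  also have "\<dots> = (\<Sum>j\<in>UNIV. \<integral>w. f j w * a (Suc n) w $ j \<partial>M)"
    by (intro Bochner_Integration.integral_sum int_fa)
  also have "\<dots> = (\<Sum>j\<in>UNIV. \<integral>w. f j w * x (Suc n) $ j \<partial>M)"
    by (simp only: key(2))
  also have "\<dots> = (\<integral>w. (\<Sum>j\<in>UNIV. f j w * x (Suc n) $ j) \<partial>M)"
    by (intro Bochner_Integration.integral_sum[symmetric] key(1))
  also have "\<dots> \<le> (\<integral>w. Z w * exp (c\<^sup>2 / 2) \<partial>M)"
  proof (rule integral_mono)
    show "integrable M (\<lambda>w. \<Sum>j\<in>UNIV. f j w * x (Suc n) $ j)"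
      by (intro Bochner_Integration.integrable_sum key(1))
    show "integrable M (\<lambda>w. Z w * exp (c\<^sup>2 / 2))" using IH(1) by simp
    fix w
    have "(\<Sum>j\<in>UNIV. f j w * x (Suc n) $ j)
        = Z w * (\<Sum>j\<in>UNIV. x (Suc n) $ j * exp (v (Suc n) w $ j - v (Suc n) w \<bullet> x (Suc n)))"
      by (simp add: f_def sum_distrib_left mult_ac)
    also have "\<dots> \<le> Z w * exp (c\<^sup>2 / 2)"
      by (intro mult_left_mono Hoeffdings_lemma_simplex x[OF T] c(1) c(2)[OF T] Zpos)
    finally show "(\<Sum>j\<in>UNIV. f j w * x (Suc n) $ j) \<le> Z w * exp (c\<^sup>2 / 2)" .
  qed
  also have "\<dots> \<le> exp (real n * c\<^sup>2 / 2) * exp (c\<^sup>2 / 2)"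
    using IH(2) by simp
  also have "\<dots> = exp (real (Suc n) * c\<^sup>2 / 2)"
    by (simp add: field_simps flip: exp_add)
  finally show ?case using int by (simp only: step)
qed

section \<open>From exponential moments to the expected squared sup norm\<close>

text \<open>
  Replaces the integration of tail probabilities: up to a constant, the right-hand side is the
  tangent at \<open>exp (\<theta> * m0)\<close> of \<open>m\<^sup>2\<close> as a function of \<open>exp (\<theta> * m)\<close>, which is concave where \<open>\<theta> * m \<ge> 1\<close>.
\<close>

lemma power2_le_exp:
  fixes m m0 \<theta> :: real
  assumes \<theta>: "\<theta> > 0" and m0: "\<theta> * m0 \<ge> 1" and m: "m \<ge> 0"
  shows "m\<^sup>2 \<le> m0\<^sup>2 + 2 * m0 / \<theta> * exp (\<theta> * (m - m0))"
proof -
  have m0pos: "m0 > 0" using \<theta> m0 by (metis less_le_trans zero_less_mult_pos zero_less_one)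
  show ?thesis
  proof (cases "m \<le> m0")
    case True
    then have "m\<^sup>2 \<le> m0\<^sup>2" using m by (intro power_mono)
    moreover have "0 \<le> 2 * m0 / \<theta> * exp (\<theta> * (m - m0))" using \<theta> m0pos by simp
    ultimately show ?thesis by linarith
  next
    case False
    define u where "u = \<theta> * (m - m0)"
    have u: "u \<ge> 0" using False \<theta> by (simp add: u_def)
    have mu: "m = m0 + u / \<theta>" using \<theta> by (simp add: u_def)
    have "2 * m0 / \<theta> * (u + u\<^sup>2 / 2) \<le> 2 * m0 / \<theta> * exp u"
      using exp_lower_Taylor_quadratic[OF u] m0pos \<theta> by (intro mult_left_mono) auto
    \<comment> \<open>The terms linear in \<open>u\<close> agree on both sides; for the quadratic
      ones, \<open>\<theta> * m0 \<ge> 1\<close> is what lets the Taylor term of exp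
      dominate.\<close>
    moreover have "(u / \<theta>)\<^sup>2 \<le> m0 / \<theta> * u\<^sup>2"
    proof -
      have "(u / \<theta>)\<^sup>2 = 1 * (u\<^sup>2 / \<theta>\<^sup>2)" by (simp add: power_divide)
      also have "\<dots> \<le> (\<theta> * m0) * (u\<^sup>2 / \<theta>\<^sup>2)" using m0 by (intro mult_right_mono) auto
      finally show ?thesis using \<theta> by (simp add: power2_eq_square field_simps)
    qed
    moreover have "m\<^sup>2 = m0\<^sup>2 + 2 * m0 / \<theta> * u + (u / \<theta>)\<^sup>2"
      by (simp add: mu power2_eq_square algebra_simps)
    ultimately show ?thesis unfolding u_def[symmetric] distrib_left by simp
  qed
qed

text \<open>A supremum over finitely many coordinates is a maximum. The maximising index will depend
  on the outcome \<open>w\<close>, so coordinate bounds have to be uniform in the index.\<close>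

lemma infnorm_attained:
  fixes z :: "real ^ 'd::finite"
  obtains i where "infnorm z = \<bar>z $ i\<bar>"
proof -
  have "infnorm z \<in> {\<bar>z $ i\<bar> |i. i \<in> UNIV}"
    unfolding infnorm_cart setcompr_eq_image
    by (subst cSup_eq_Max) (auto simp del: image_iff intro!: Max_in)
  with that show ?thesis by auto
qed

theorem corollary2p7:
  fixes F :: "real ^ 'd::finite \<Rightarrow> real"
    and L1 L2 :: real
    and T :: nat
    and M :: "'w measure"
    and x :: "nat \<Rightarrow> real ^ 'd"
    and a :: "nat \<Rightarrow> 'w \<Rightarrow> real ^ 'd"
  assumes "smooth_l1 L1 F"
    and "\<And>i. smooth_l1 L2 (partial_deriv i F)"
    and "T \<ge> 1"
    and "prob_space M"
    and "\<And>t. t \<in> {1..T} \<Longrightarrow> x t \<in> prob_simplex"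
    and "\<And>t. t \<in> {1..T} \<Longrightarrow> a t \<in> borel_measurable M"
    and "\<And>t. t \<in> {1..T} \<Longrightarrow> AE w in M. a t w \<in> prob_simplex"
    and "\<And>t. t \<in> {1..T} \<Longrightarrow>
           AE w in M. vec_cond_exp M (gen_sigma M {1..<t} a) (a t) w = x t"
  defines "xbar \<equiv> (1 / real T) *\<^sub>R (\<Sum>t=1..T. x t)"
    and "abar \<equiv> (\<lambda>w. (1 / real T) *\<^sub>R (\<Sum>t=1..T. a t w))"
  shows "integrable M (\<lambda>w. (infnorm (grad F (abar w) - grad F xbar))\<^sup>2) \<and>
         prob_space.expectation M (\<lambda>w. (infnorm (grad F (abar w) - grad F xbar))\<^sup>2)
           \<le> 8 * L2\<^sup>2 / (real T)\<^sup>2 + 8 * L1\<^sup>2 * (4 + ln (real CARD('d))) / real T"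
proof (cases "L1 > 0")
  \<comment> \<open>Here the Lipschitz bound forces \<open>grad F\<close> to be constant. The case
    is split off because the variance proxy must be positive to be divided by.\<close>
  case False
  have lnd: "0 \<le> ln (real CARD('d))" by simp
  have "infnorm (grad F (abar w) - grad F xbar) = 0" for w
  proof -
    have "infnorm (grad F (abar w) - grad F xbar) \<le> L1 * l1_norm (abar w - xbar)"
      using assms(1) by (simp add: smooth_l1_def)
    also have "\<dots> \<le> 0" using False by (intro mult_nonpos_nonneg l1_norm_nonneg) simp
    finally show ?thesis using infnorm_pos_le by (metis antisym)
  qed
  then show ?thesis using lnd by simp
next
  case L1: True
  interpret prob_space M by fact
  define d where "d = real CARD('d)"
  have d: "d \<ge> 1" unfolding d_def by simp
  have T: "real T > 0" using assms(3) by simp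
  define g where "g i = partial_deriv i F" for i
  have g: "smooth_l1 L2 (g i)" for i unfolding g_def by (rule assms(2))
  \<comment> \<open>Only steps \<open>s < t\<close> enter, so \<open>y t\<close> is known before
    \<open>a t\<close> and the coefficients \<open>V i t\<close> are predictable.\<close>
  define y where "y t w = xbar + (1 / real T) *\<^sub>R (\<Sum>s=1..<t. a s w - x s)" for t w
  define V where "V i t w = (1 / real T) *\<^sub>R grad (g i) (y t w)" for i t w
  define S where "S i w = (\<Sum>t=1..T. V i t w \<bullet> (a t w - x t))" for i w
  define D where "D w = infnorm (grad F (abar w) - grad F xbar)" for w

  \<comment> \<open>\<open>g i\<close> is a component of \<open>grad F\<close>, hence
    \<open>L1\<close>-Lipschitz; its partial derivatives inherit that constant as a bound.\<close>
  have grad_g: "\<bar>grad (g i) u $ j\<bar> \<le> L1" for i u j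
  proof (rule grad_bound_of_lipschitz)
    show "g i differentiable (at u)" by (rule smooth_l1D(1)[OF g])
    show "\<bar>g i w - g i u\<bar> \<le> L1 * l1_norm (w - u)" for w
      using smooth_l1D(2)[OF assms(1), of w i u] by (simp add: grad_def g_def)
  qed
  have V_bound: "\<bar>V i t w $ j\<bar> \<le> L1 / real T" for i t w j
    using grad_g[of i "y t w" j] T by (simp add: V_def abs_mult divide_right_mono)
  have V_meas: "V i t \<in> borel_measurable (gen_sigma M {1..<t} a)" for i t
  proof -
    have "(\<lambda>w. \<Sum>s=1..<t. a s w - x s) \<in> borel_measurable (gen_sigma M {1..<t} a)"
      by (intro borel_measurable_sum borel_measurable_diff measurable_gen_sigma) auto
    then have "y t \<in> borel_measurable (gen_sigma M {1..<t} a)"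
      unfolding y_def by measurable
    moreover have "grad (g i) \<in> borel_measurable borel"
      by (intro borel_measurable_continuous_onI continuous_on_grad[OF g])
    ultimately have "(\<lambda>w. grad (g i) (y t w)) \<in> borel_measurable (gen_sigma M {1..<t} a)"
      by (rule measurable_compose)
    then show ?thesis unfolding V_def by measurable
  qed

  \<comment> \<open>\<open>\<theta> = m0 / \<sigma>2\<close> minimises
    \<open>\<theta>\<^sup>2 * \<sigma>2 / 2 - \<theta> * m0\<close>, with minimum
    \<open>- (1 + ln d)\<close>, so a sum over \<open>d\<close> coordinates stays bounded. The
    summand 1 keeps \<open>m0\<close> positive and \<open>\<theta> * m0 \<ge> 1\<close> also when
    \<open>d = 1\<close>.\<close>
  define \<sigma>2 where "\<sigma>2 = L1\<^sup>2 / real T"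
  define m0 where "m0 = sqrt (2 * \<sigma>2 * (1 + ln d))"
  define \<theta> where "\<theta> = m0 / \<sigma>2"
  have \<sigma>2: "\<sigma>2 > 0" using L1 T by (simp add: \<sigma>2_def)
  have lnd: "ln d \<ge> 0" using d by simp
  have m0sq: "m0\<^sup>2 = 2 * \<sigma>2 * (1 + ln d)"
    unfolding m0_def using \<sigma>2 lnd by (intro real_sqrt_pow2) auto
  have m0: "m0 > 0" unfolding m0_def using \<sigma>2 lnd by simp
  have \<theta>: "\<theta> > 0" using m0 \<sigma>2 by (simp add: \<theta>_def)
  have \<theta>m0: "\<theta> * m0 = 2 * (1 + ln d)"
    using m0sq \<sigma>2 by (simp add: \<theta>_def power2_eq_square field_simps)
  have \<theta>sq: "\<theta>\<^sup>2 * \<sigma>2 / 2 = 1 + ln d"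
    using m0sq \<sigma>2 by (simp add: \<theta>_def power2_eq_square field_simps)
  have m0_div: "2 * m0 / \<theta> = 2 * \<sigma>2"
    using m0 by (simp add: \<theta>_def)

  \<comment> \<open>Both signs are needed to control the absolute value of
    \<open>S i w\<close>.\<close>
  have mgf: "integrable M (\<lambda>w. exp (r * S i w)) \<and> (\<integral>w. exp (r * S i w) \<partial>M) \<le> exp (1 + ln d)"
    if r: "r = \<theta> \<or> r = - \<theta>" for r i
  proof -
    have "integrable M (\<lambda>w. exp (\<Sum>t=1..T. (r *\<^sub>R V i t w) \<bullet> (a t w - x t))) \<and>
      (\<integral>w. exp (\<Sum>t=1..T. (r *\<^sub>R V i t w) \<bullet> (a t w - x t)) \<partial>M)
        \<le> exp (real T * (\<theta> * (L1 / real T))\<^sup>2 / 2)"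
    proof (rule exp_martingale_bound[where T = T and v = "\<lambda>t w. r *\<^sub>R V i t w"])
      show "0 < \<theta> * (L1 / real T)" using \<theta> L1 T by simp
      show "(\<lambda>w. r *\<^sub>R V i t w) \<in> borel_measurable (gen_sigma M {1..<t} a)" for t
        using V_meas by measurable
      have "\<bar>r\<bar> = \<theta>" using r \<theta> by auto
      then show "\<bar>(r *\<^sub>R V i t w) $ j\<bar> \<le> \<theta> * (L1 / real T)" for t w j
        using mult_left_mono[OF V_bound[of i t w j], of \<theta>] \<theta> by (simp add: abs_mult)
    qed (use assms in auto)
    moreover have "real T * (\<theta> * (L1 / real T))\<^sup>2 / 2 = 1 + ln d"
      unfolding \<theta>sq[symmetric] \<sigma>2_def using T by (simp add: power2_eq_square field_simps)
    moreover have "(\<Sum>t=1..T. (r *\<^sub>R V i t w) \<bullet> (a t w - x t)) = r * S i w" for w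
      by (simp add: S_def sum_distrib_left)
    ultimately show ?thesis by (simp only:)
  qed

  then have mgf_int: "integrable M (\<lambda>w. exp (\<theta> * S i w))" "integrable M (\<lambda>w. exp (- \<theta> * S i w))" for i
    by blast+

  \<comment> \<open>One integrable majorant of the exponential of \<open>\<theta>\<close> times the
    absolute value of \<open>S i w\<close>, for all \<open>i\<close> at once: the maximum over
    coordinates costs a factor \<open>2 * d\<close> in expectation.\<close>
  define E where "E w = (\<Sum>i\<in>UNIV. exp (\<theta> * S i w) + exp (- \<theta> * S i w))" for w
  have E_int: "integrable M E"
    unfolding E_def using mgf_int
    by (intro Bochner_Integration.integrable_sum Bochner_Integration.integrable_add) auto
  have "(\<integral>w. E w \<partial>M) = (\<Sum>i\<in>UNIV. (\<integral>w. exp (\<theta> * S i w) \<partial>M) + (\<integral>w. exp (- \<theta> * S i w) \<partial>M))"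
    unfolding E_def using mgf_int
    by (subst Bochner_Integration.integral_sum)
       (auto intro!: sum.cong Bochner_Integration.integral_add)
  also have "\<dots> \<le> (\<Sum>i\<in>(UNIV::'d set). exp (1 + ln d) + exp (1 + ln d))"
    using mgf by (intro sum_mono add_mono) blast+
  also have "\<dots> = 2 * d * exp (1 + ln d)"
    by (simp add: d_def)
  finally have E_le: "(\<integral>w. E w \<partial>M) \<le> 2 * d * exp (1 + ln d)" .

  have S_sq: "(S i w)\<^sup>2 \<le> m0\<^sup>2 + 2 * \<sigma>2 * exp (- (\<theta> * m0)) * E w" for i w
  proof -
    have "\<bar>S i w\<bar>\<^sup>2 \<le> m0\<^sup>2 + 2 * m0 / \<theta> * exp (\<theta> * (\<bar>S i w\<bar> - m0))"
      using \<theta> \<theta>m0 lnd by (intro power2_le_exp) auto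
    also have "exp (\<theta> * (\<bar>S i w\<bar> - m0)) = exp (- (\<theta> * m0)) * exp (\<theta> * \<bar>S i w\<bar>)"
      by (simp add: algebra_simps flip: exp_add)
    finally have A: "(S i w)\<^sup>2 \<le> m0\<^sup>2 + 2 * \<sigma>2 * (exp (- (\<theta> * m0)) * exp (\<theta> * \<bar>S i w\<bar>))"
      by (simp add: m0_div)
    have "exp (\<theta> * \<bar>S i w\<bar>) \<le> exp (\<theta> * S i w) + exp (- \<theta> * S i w)"
      by (cases "S i w \<ge> 0") auto
    also have "\<dots> \<le> E w"
      unfolding E_def
      by (rule member_le_sum[where f = "\<lambda>i. exp (\<theta> * S i w) + exp (- \<theta> * S i w)"]) auto
    finally have "2 * \<sigma>2 * (exp (- (\<theta> * m0)) * exp (\<theta> * \<bar>S i w\<bar>))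
        \<le> 2 * \<sigma>2 * (exp (- (\<theta> * m0)) * E w)"
      using \<sigma>2 by (intro mult_left_mono) auto
    with A show ?thesis by (simp add: mult.assoc)
  qed

  have AE_simplex: "AE w in M. \<forall>t\<in>{1..T}. a t w \<in> prob_simplex"
    using assms(7) by (intro AE_finite_allI) auto

  \<comment> \<open>The guard matters: \<open>{1..<0}\<close> and \<open>{1..<1}\<close> are both
    empty, so \<open>y 0\<close> and \<open>y 1\<close> coincide.\<close>
  have y_Suc: "y (Suc t) w = y t w + (1 / real T) *\<^sub>R (a t w - x t)" if "t \<ge> 1" for t w
    using that by (simp add: y_def scaleR_right_distrib)
  have y_1: "y 1 w = xbar" for w by (simp add: y_def)
  have y_T: "y (Suc T) w = abar w" for w
    by (simp add: y_def xbar_def abar_def atLeastLessThanSuc_atLeastAtMost sum_subtractf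
        scaleR_right_diff_distrib)

  \<comment> \<open>For such \<open>w\<close>, \<open>a t w\<close> is at l1 distance at most 2 from
    \<open>x t\<close>, so each of the \<open>T\<close> steps costs at most
    \<open>L2 / 2 * (2 / real T)\<^sup>2\<close>. The differences of \<open>g i\<close> telescope
    from \<open>y 1\<close> to \<open>y (Suc T)\<close>.\<close>
  have err: "\<bar>g i (abar w) - g i xbar - S i w\<bar> \<le> 2 * L2 / real T"
    if w: "\<forall>t\<in>{1..T}. a t w \<in> prob_simplex" for i w
  proof -
    define e where "e t = g i (y (Suc t) w) - g i (y t w) - V i t w \<bullet> (a t w - x t)" for t
    have e: "\<bar>e t\<bar> \<le> 2 * L2 / (real T)\<^sup>2" if t: "t \<in> {1..T}" for t
    proof -
      define h where "h = (1 / real T) *\<^sub>R (a t w - x t)"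
      \<comment> \<open>The sign is not part of \<open>smooth_l1\<close>; it follows from the
        Lipschitz bound between two points at l1 distance 1.\<close>
      have L2: "0 \<le> L2"
      proof -
        have "0 \<le> L2 * l1_norm (axis i (1::real) - 0)"
          using smooth_l1D(2)[OF g, of i "axis i 1" i 0] by linarith
        then show ?thesis by (simp add: l1_norm_axis)
      qed
      have "l1_norm h \<le> 2 / real T"
        using l1_norm_diff_simplex[of "a t w" "x t"] w t assms(5)[OF t] T
        by (simp add: h_def l1_norm_scaleR divide_right_mono)
      then have "(l1_norm h)\<^sup>2 \<le> (2 / real T)\<^sup>2"
        by (intro power_mono l1_norm_nonneg)
      then have "L2 / 2 * (l1_norm h)\<^sup>2 \<le> L2 / 2 * (2 / real T)\<^sup>2"
        using L2 by (intro mult_left_mono) auto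
      moreover have "\<bar>e t\<bar> \<le> L2 / 2 * (l1_norm h)\<^sup>2"
        using first_order_error[OF g, of i "y t w" h] t
        by (simp add: e_def h_def V_def y_Suc)
      ultimately show ?thesis by (simp add: power_divide)
    qed
    have "(\<Sum>t=1..T. e t) = (\<Sum>t=1..T. g i (y (Suc t) w) - g i (y t w)) - S i w"
      by (simp add: e_def S_def sum_subtractf)
    also have "(\<Sum>t=1..T. g i (y (Suc t) w) - g i (y t w)) = g i (abar w) - g i xbar"
      using sum_Suc_diff[of 1 T "\<lambda>t. g i (y t w)"] by (simp only: y_1 y_T)
    finally have "\<bar>g i (abar w) - g i xbar - S i w\<bar> \<le> (\<Sum>t=1..T. \<bar>e t\<bar>)"
      using sum_abs[of e "{1..T}"] by simp
    also have "\<dots> \<le> (\<Sum>t=1..T. 2 * L2 / (real T)\<^sup>2)"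
      by (intro sum_mono e)
    also have "\<dots> = 2 * L2 / real T"
      using T by (simp add: power2_eq_square)
    finally show ?thesis .
  qed

  define B where "B w = 8 * L2\<^sup>2 / (real T)\<^sup>2 + 2 * (m0\<^sup>2 + 2 * \<sigma>2 * exp (- (\<theta> * m0)) * E w)" for w
  have D_le: "AE w in M. (D w)\<^sup>2 \<le> B w"
    using AE_simplex
  proof eventually_elim
    case (elim w)
    obtain i where i: "D w = \<bar>(grad F (abar w) - grad F xbar) $ i\<bar>"
      unfolding D_def by (rule infnorm_attained)
    \<comment> \<open>The second-order remainder. The square of \<open>r + S i w\<close> is at most
      twice the sum of the squares, and \<open>2 * (2 * L2 / real T)\<^sup>2\<close> is the first
      term of the claim.\<close>
    define r where "r = g i (abar w) - g i xbar - S i w"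
    have r: "r\<^sup>2 \<le> (2 * L2 / real T)\<^sup>2"
      using err[OF elim, of i] unfolding r_def by (metis abs_ge_zero power2_abs power_mono)
    have "(D w)\<^sup>2 = (r + S i w)\<^sup>2"
      unfolding i by (simp add: grad_def g_def r_def)
    also have "\<dots> \<le> 2 * r\<^sup>2 + 2 * (S i w)\<^sup>2"
      using sum_squares_bound[of r "S i w"] by (simp add: power2_sum)
    also have "\<dots> \<le> 2 * (2 * L2 / real T)\<^sup>2 + 2 * (m0\<^sup>2 + 2 * \<sigma>2 * exp (- (\<theta> * m0)) * E w)"
      by (intro add_mono mult_left_mono r S_sq) auto
    also have "2 * (2 * L2 / real T)\<^sup>2 = 8 * L2\<^sup>2 / (real T)\<^sup>2"
      by (simp add: power_divide power_mult_distrib)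
    finally show ?case unfolding B_def .
  qed
  have B_int: "integrable M B"
    unfolding B_def using E_int by simp
  have D_meas: "(\<lambda>w. (D w)\<^sup>2) \<in> borel_measurable M"
  proof -
    have "abar \<in> borel_measurable M"
      unfolding abar_def using assms(6) by (intro borel_measurable_scaleR borel_measurable_sum) auto
    moreover have "continuous_on UNIV (\<lambda>z. (infnorm (grad F z - grad F xbar))\<^sup>2)"
      by (intro continuous_intros continuous_on_grad[OF assms(1)])
    ultimately show ?thesis
      unfolding D_def by (rule measurable_compose[OF _ borel_measurable_continuous_onI])
  qed
  have D_int: "integrable M (\<lambda>w. (D w)\<^sup>2)"
  proof (rule Bochner_Integration.integrable_bound[OF B_int D_meas])
    show "AE w in M. norm ((D w)\<^sup>2) \<le> norm (B w)"
      using D_le by eventually_elim (simp add: order_trans[OF _ abs_ge_self])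
  qed
  \<comment> \<open>The dimension cancels: \<open>\<theta> * m0\<close> is twice
    \<open>1 + ln d\<close>, which pays for the moment bound and for the factor
    \<open>d\<close>.\<close>
  have E_factor: "exp (- (\<theta> * m0)) * (2 * d * exp (1 + ln d)) = 2 * exp (- 1)"
  proof -
    have "d * exp (1 + ln d) = exp (ln d) * exp (1 + ln d)" using d by simp
    then have "exp (- (\<theta> * m0)) * (2 * d * exp (1 + ln d))
        = 2 * (exp (- (\<theta> * m0)) * (exp (ln d) * exp (1 + ln d)))" by simp
    also have "\<dots> = 2 * exp (- 1)"
      unfolding \<theta>m0 by (simp flip: exp_add)
    finally show ?thesis .
  qed
  have "(\<integral>w. (D w)\<^sup>2 \<partial>M) \<le> (\<integral>w. B w \<partial>M)"
    by (rule integral_mono_AE[OF D_int B_int D_le])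
  also have "\<dots> = 8 * L2\<^sup>2 / (real T)\<^sup>2 + 2 * (m0\<^sup>2 + 2 * \<sigma>2 * exp (- (\<theta> * m0)) * (\<integral>w. E w \<partial>M))"
    unfolding B_def using E_int by (simp add: prob_space)
  also have "\<dots> \<le> 8 * L2\<^sup>2 / (real T)\<^sup>2 +
      2 * (m0\<^sup>2 + 2 * \<sigma>2 * exp (- (\<theta> * m0)) * (2 * d * exp (1 + ln d)))"
    using E_le \<sigma>2 by (intro add_left_mono mult_left_mono) auto
  also have "2 * \<sigma>2 * exp (- (\<theta> * m0)) * (2 * d * exp (1 + ln d)) = 2 * \<sigma>2 * (2 * exp (- 1))"
    by (simp only: mult.assoc[of "2 * \<sigma>2"] E_factor)
  also have "\<dots> \<le> 2 * \<sigma>2 * 2"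
    using \<sigma>2 by (intro mult_left_mono) auto
  finally have "(\<integral>w. (D w)\<^sup>2 \<partial>M) \<le> 8 * L2\<^sup>2 / (real T)\<^sup>2 + 2 * (m0\<^sup>2 + 2 * \<sigma>2 * 2)"
    by simp
  \<comment> \<open>By \<open>m0sq\<close> the left side is
    \<open>\<sigma>2 * (12 + 4 * ln d)\<close>, so the constants leave slack.\<close>
  also have "2 * (m0\<^sup>2 + 2 * \<sigma>2 * 2) \<le> 8 * \<sigma>2 * (4 + ln d)"
    using \<sigma>2 lnd unfolding m0sq by (simp add: algebra_simps)
  finally have "(\<integral>w. (D w)\<^sup>2 \<partial>M) \<le> 8 * L2\<^sup>2 / (real T)\<^sup>2 + 8 * L1\<^sup>2 * (4 + ln d) / real T"
    by (simp add: \<sigma>2_def)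
  with D_int show ?thesis by (simp add: D_def d_def)
qed

end
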